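(* For positive integers $q$ and $n$, let $u_{\mathbb B}(q;n)$ be the number of ways to place $q$ unlabelled nonattacking bishops on an $n\times n$ chessboard. For every $q\ge 3$, the quasipolynomial function $n\mapsto q!\,u_{\mathbb B}(q;n)$ has period equal to $2$. For $q<3$ (that is, $q\in\{1,2\}$) the period of $n\mapsto q!\,u_{\mathbb B}(q;n)$ is $1$.
   Context: The $n\times n$ board is the set of points $(x,y)\in\mathbb Z^2$ with $1\le x,y\le n$. Two bishops at positions $z_i=(x_i,y_i)$ and $z_j=(x_j,y_j)$ attack each other if $z_j-z_i$ is an integral multiple (possibly zero) of $(1,1)$ or of $(1,-1)$; pieces in between do not block attacks. A placement of $q$ bishops is nonattacking if no two of the bishops attack each other. The number $u_{\mathbb B}(q;n)$ counts the $q$-element sets of board positions that are nonattacking, so $q!\,u_{\mathbb B}(q;n)$ is the number of nonattacking placements of $q$ labelled bishops. A function $f$ of positive integers $n$ is a quasipolynomial if there are a positive integer $p$ and polynomials $f_0,\dots,f_{p-1}\in\mathbb Q[n]$ such that $f(n)=f_{n \bmod p}(n)$ for all $n\ge 1$. The period of $f$ is the smallest such $p$. (It is known that, for each fixed $q$, $q!\,u_{\mathbb B}(q;n)$ is a quasipolynomial function of $n$, of degree $2q$.) *)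

theory Defs
  imports Complex_Main "HOL-Computational_Algebra.Polynomial"
begin

definition board :: "nat \<Rightarrow> (int \<times> int) set" where
  "board n = {(x, y). 1 \<le> x \<and> x \<le> int n \<and> 1 \<le> y \<and> y \<le> int n}"

text \<open>The multiple \<open>k\<close> may be zero, so a position attacks itself; in \<open>nonattacking\<close> only pairs of
  distinct positions are compared.\<close>

definition bishop_attacks :: "int \<times> int \<Rightarrow> int \<times> int \<Rightarrow> bool" where
  "bishop_attacks z w \<longleftrightarrow>
    (\<exists>k::int. (fst w - fst z, snd w - snd z) = (k * 1, k * 1)
            \<or> (fst w - fst z, snd w - snd z) = (k * 1, k * (- 1)))"

definition nonattacking :: "(int \<times> int) set \<Rightarrow> bool" where
  "nonattacking S \<longleftrightarrow> pairwise (\<lambda>z w. \<not> bishop_attacks z w) S"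

definition bishop_count :: "nat \<Rightarrow> nat \<Rightarrow> nat" where
  "bishop_count q n = card {S. S \<subseteq> board n \<and> card S = q \<and> nonattacking S}"

text \<open>Functions of a positive integer are functions on \<open>nat\<close> whose value at \<open>0\<close> is ignored.\<close>

definition quasipolynomial_mod :: "nat \<Rightarrow> (nat \<Rightarrow> rat) \<Rightarrow> bool" where
  "quasipolynomial_mod p f \<longleftrightarrow>
    p > 0 \<and> (\<exists>F :: nat \<Rightarrow> rat poly. \<forall>n\<ge>1. f n = poly (F (n mod p)) (of_nat n))"

definition quasipolynomial :: "(nat \<Rightarrow> rat) \<Rightarrow> bool" where
  "quasipolynomial f \<longleftrightarrow> (\<exists>p. quasipolynomial_mod p f)"

text \<open>Meaningful only if \<open>quasipolynomial f\<close> holds.\<close>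

definition period :: "(nat \<Rightarrow> rat) \<Rightarrow> nat" where
  "period f = (LEAST p. quasipolynomial_mod p f)"

end

theory Submission
  imports Defs "HOL-Combinatorics.Stirling"
begin

text \<open>
  Bishops of different colours do not interact. Adding the diagonals \<open>x - y = d\<close> of one colour by
  increasing length, every earlier cell attacks exactly one cell of the new diagonal, so the numbers
  of placements obey a rook recursion. In the basis of falling factorials of degrees \<open>n - k\<close> they are
  the coefficients of \<open>(x + 1)\<^sup>n\<^sup>-\<^sup>b x\<^sup>b\<close>, where \<open>b\<close> is \<open>n/2\<close> rounded down for one colour and up for
  the other. Hence the count is given by one polynomial in \<open>n\<close> for even \<open>n\<close> and one for odd \<open>n\<close>.

  At \<open>n = -1\<close> the polynomial for odd \<open>n\<close> takes the value \<open>q!\<close>, and that for even \<open>n\<close> the value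
  \<open>\<Sum>i\<le>q. h\<^sub>i h\<^sub>q\<^sub>-\<^sub>i\<close> with \<open>h\<^sub>k = \<Sum>j. c(k, j) (2j choose j) / 4\<^sup>j\<close>, \<open>c(k, j)\<close> being the unsigned Stirling
  numbers of the first kind. As \<open>h\<^sub>k / k!\<close> is decreasing in \<open>k\<close>, this sum is less than \<open>q!\<close> for
  \<open>q \<ge> 3\<close>, so the two polynomials differ; for \<open>q \<le> 2\<close> they depend only on the sum \<open>n\<close> of the two
  values of \<open>b\<close>, and coincide.
\<close>

section \<open>Placements on nested diagonals\<close>

lemma bishop_attacks_iff:
  "bishop_attacks z w \<longleftrightarrow> fst z - snd z = fst w - snd w \<or> fst z + snd z = fst w + snd w"
proof
  assume "bishop_attacks z w"
  then show "fst z - snd z = fst w - snd w \<or> fst z + snd z = fst w + snd w"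
    unfolding bishop_attacks_def by auto
next
  assume "fst z - snd z = fst w - snd w \<or> fst z + snd z = fst w + snd w"
  then show "bishop_attacks z w"
    unfolding bishop_attacks_def by (intro exI[of _ "fst w - fst z"]) auto
qed

lemma bishop_attacks_sym: "bishop_attacks z w \<longleftrightarrow> bishop_attacks w z"
  by (auto simp: bishop_attacks_iff)

definition placements :: "(int \<times> int) set \<Rightarrow> nat \<Rightarrow> (int \<times> int) set set" where
  "placements B k = {S. S \<subseteq> B \<and> card S = k \<and> nonattacking S}"

lemma finite_placements: "finite B \<Longrightarrow> finite (placements B k)"
  unfolding placements_def by (rule finite_subset[of _ "Pow B"]) auto

lemma placements_0: "finite B \<Longrightarrow> placements B 0 = {{}}"
  unfolding placements_def nonattacking_def by (auto dest: finite_subset)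

lemma placements_empty_Suc: "placements {} (Suc k) = {}"
  unfolding placements_def by auto

lemma nonattacking_insert:
  assumes "w \<notin> S"
  shows "nonattacking (insert w S) \<longleftrightarrow> nonattacking S \<and> (\<forall>z\<in>S. \<not> bishop_attacks z w)"
  using assms unfolding nonattacking_def pairwise_insert by (metis bishop_attacks_sym)

text \<open>Two cells of \<open>B\<close> that attack the same cell of \<open>D\<close> attack each
  other, so the cells of a nonattacking \<open>S\<close> hit distinct cells of
  \<open>D\<close>.\<close>

lemma card_attacked:
  assumes D: "\<And>z. z \<in> B \<Longrightarrow> \<exists>!w. w \<in> D \<and> bishop_attacks z w"
    and inj: "\<And>z z' w. \<lbrakk>z \<in> B; z' \<in> B; w \<in> D; bishop_attacks z w; bishop_attacks z' w\<rbrakk>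
      \<Longrightarrow> bishop_attacks z z'"
    and S: "S \<in> placements B k"
  shows "card {w \<in> D. \<exists>z\<in>S. bishop_attacks z w} = k"
proof -
  define f where "f z = (THE w. w \<in> D \<and> bishop_attacks z w)" for z
  have f: "f z \<in> D \<and> bishop_attacks z (f z)" if "z \<in> B" for z
    unfolding f_def by (rule theI'[OF D[OF that]])
  have SB: "S \<subseteq> B" and na: "nonattacking S" and c: "card S = k"
    using S by (auto simp: placements_def)
  have "{w \<in> D. \<exists>z\<in>S. bishop_attacks z w} = f ` S"
    using f SB D by blast
  moreover have "inj_on f S"
  proof (rule inj_onI, rule ccontr)
    fix z z' assume z: "z \<in> S" "z' \<in> S" "f z = f z'" "z \<noteq> z'"
    then have "bishop_attacks z z'"
      using inj[of z z' "f z"] f SB by (metis subsetD)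
    then show False
      using na z by (auto simp: nonattacking_def pairwise_def)
  qed
  ultimately show ?thesis
    using c by (simp add: card_image)
qed

text \<open>The cells of \<open>D\<close> attack one another, so a placement has at most one bishop
  there, and \<open>k\<close> bishops on \<open>B\<close> leave \<open>card D - k\<close> cells for
  it. The term with factor \<open>k\<close> stands on the left to avoid truncated
  subtraction.\<close>

lemma card_placements_Un:
  assumes fin: "finite B" "finite D" and disj: "B \<inter> D = {}"
    and DD: "\<And>z w. \<lbrakk>z \<in> D; w \<in> D\<rbrakk> \<Longrightarrow> bishop_attacks z w"
    and D: "\<And>z. z \<in> B \<Longrightarrow> \<exists>!w. w \<in> D \<and> bishop_attacks z w"
    and inj: "\<And>z z' w. \<lbrakk>z \<in> B; z' \<in> B; w \<in> D; bishop_attacks z w; bishop_attacks z' w\<rbrakk>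
      \<Longrightarrow> bishop_attacks z z'"
  shows "card (placements (B \<union> D) (Suc k)) + k * card (placements B k) =
         card (placements B (Suc k)) + card D * card (placements B k)"
proof -
  define free where "free S = {w \<in> D. \<forall>z\<in>S. \<not> bishop_attacks z w}" for S
  let ?g = "\<lambda>(S, w). insert w S"
  let ?P = "Sigma (placements B k) free"
  have free: "card (free S) + k = card D" if "S \<in> placements B k" for S
  proof -
    have "card (free S \<union> {w \<in> D. \<exists>z\<in>S. bishop_attacks z w})
        = card (free S) + card {w \<in> D. \<exists>z\<in>S. bishop_attacks z w}"
      using fin by (intro card_Un_disjoint) (auto simp: free_def)
    moreover have "free S \<union> {w \<in> D. \<exists>z\<in>S. bishop_attacks z w} = D"
      by (auto simp: free_def)
    ultimately have "card D = card (free S) + card {w \<in> D. \<exists>z\<in>S. bishop_attacks z w}"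
      by simp
    then show ?thesis
      using card_attacked[OF D inj that] by simp
  qed
  have inj_g: "inj_on ?g ?P"
  proof (rule inj_onI, clarify)
    fix S w S' w'
    assume a: "S \<in> placements B k" "w \<in> free S" "S' \<in> placements B k" "w' \<in> free S'"
      "insert w S = insert w' S'"
    then have "S \<subseteq> B" "S' \<subseteq> B" "w \<in> D" "w' \<in> D"
      by (auto simp: placements_def free_def)
    then have "S = insert w S \<inter> B" "S' = insert w' S' \<inter> B"
      "{w} = insert w S \<inter> D" "{w'} = insert w' S' \<inter> D"
      using disj by auto
    then show "S = S' \<and> w = w'"
      using a(5) by (metis singleton_inject)
  qed
  have eq: "placements (B \<union> D) (Suc k) = placements B (Suc k) \<union> ?g ` ?P"
  proof (intro equalityI subsetI)
    fix T assume T: "T \<in> placements (B \<union> D) (Suc k)"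
    then have TT: "T \<subseteq> B \<union> D" "card T = Suc k" "nonattacking T"
      by (auto simp: placements_def)
    show "T \<in> placements B (Suc k) \<union> ?g ` ?P"
    proof (cases "T \<subseteq> B")
      case True
      then show ?thesis using TT by (auto simp: placements_def)
    next
      case False
      then obtain w where w: "w \<in> T" "w \<in> D" using TT by auto
      define S where "S = T - {w}"
      have Tw: "T = insert w S" "w \<notin> S" using w by (auto simp: S_def)
      have na: "nonattacking S" "\<forall>z\<in>S. \<not> bishop_attacks z w"
        using TT Tw nonattacking_insert by blast+
      \<comment> \<open>A second bishop on \<open>D\<close> would attack \<open>w\<close>.\<close>
      then have "S \<subseteq> B" using TT Tw w DD by blast
      moreover have "card S = k"
        using TT Tw by (metis S_def card_Diff_singleton diff_Suc_1 w(1))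
      ultimately have "S \<in> placements B k" "w \<in> free S"
        using na w by (auto simp: placements_def free_def)
      then show ?thesis using Tw by force
    qed
  next
    fix T assume "T \<in> placements B (Suc k) \<union> ?g ` ?P"
    then show "T \<in> placements (B \<union> D) (Suc k)"
    proof
      assume "T \<in> placements B (Suc k)"
      then show ?thesis by (auto simp: placements_def)
    next
      assume "T \<in> ?g ` ?P"
      then obtain S w where Sw: "S \<in> placements B k" "w \<in> free S" "T = insert w S" by auto
      then have S: "S \<subseteq> B" "card S = k" "nonattacking S" "w \<in> D" "\<forall>z\<in>S. \<not> bishop_attacks z w"
        by (auto simp: placements_def free_def)
      then have "w \<notin> S" "finite S" using disj fin finite_subset by auto
      then show ?thesis
        using S Sw nonattacking_insert by (auto simp: placements_def)
    qed
  qed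
  have dis: "placements B (Suc k) \<inter> ?g ` ?P = {}"
    using disj by (auto simp: placements_def free_def)
  have finP: "finite ?P"
    using fin finite_placements by (auto simp: free_def intro!: finite_SigmaI)
  have "card (placements (B \<union> D) (Suc k)) = card (placements B (Suc k)) + card ?P"
    unfolding eq using dis finP finite_placements[OF fin(1)] inj_g
    by (subst card_Un_disjoint) (auto simp: card_image)
  also have "card ?P = (\<Sum>S\<in>placements B k. card (free S))"
    using fin finite_placements by (intro card_SigmaI) (auto simp: free_def)
  finally have "card (placements (B \<union> D) (Suc k)) + k * card (placements B k) =
      card (placements B (Suc k)) + (\<Sum>S\<in>placements B k. card (free S) + k)"
    by (simp add: sum.distrib)
  also have "(\<Sum>S\<in>placements B k. card (free S) + k) = card D * card (placements B k)"
    using free by simp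
  finally show ?thesis .
qed

lemma nonattacking_Un:
  assumes "\<And>z w. \<lbrakk>z \<in> S; w \<in> T\<rbrakk> \<Longrightarrow> \<not> bishop_attacks z w"
  shows "nonattacking (S \<union> T) \<longleftrightarrow> nonattacking S \<and> nonattacking T"
  unfolding nonattacking_def pairwise_def using assms bishop_attacks_sym by blast

lemma card_placements_Un_separate:
  assumes fin: "finite A" "finite B" and disj: "A \<inter> B = {}"
    and sep: "\<And>z w. \<lbrakk>z \<in> A; w \<in> B\<rbrakk> \<Longrightarrow> \<not> bishop_attacks z w"
  shows "card (placements (A \<union> B) q) =
    (\<Sum>i\<le>q. card (placements A i) * card (placements B (q - i)))"
proof -
  let ?g = "\<lambda>(S, T). S \<union> T"
  let ?P = "\<Union>i\<le>q. placements A i \<times> placements B (q - i)"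
  have inj: "inj_on ?g ?P"
  proof (rule inj_onI, clarify)
    fix S T S' T' i j
    assume a: "S \<in> placements A i" "T \<in> placements B (q - i)"
      "S' \<in> placements A j" "T' \<in> placements B (q - j)" "S \<union> T = S' \<union> T'"
    then have "S \<subseteq> A" "S' \<subseteq> A" "T \<subseteq> B" "T' \<subseteq> B"
      by (auto simp: placements_def)
    then have "S = (S \<union> T) \<inter> A" "S' = (S' \<union> T') \<inter> A" "T = (S \<union> T) \<inter> B" "T' = (S' \<union> T') \<inter> B"
      using disj by auto
    then show "S = S' \<and> T = T'" using a(5) by metis
  qed
  have "placements (A \<union> B) q = ?g ` ?P"
  proof (intro equalityI subsetI)
    fix U assume "U \<in> placements (A \<union> B) q"
    then have U: "U \<subseteq> A \<union> B" "card U = q" "nonattacking U"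
      by (auto simp: placements_def)
    have eq: "U = (U \<inter> A) \<union> (U \<inter> B)" using U by auto
    have "card U = card (U \<inter> A) + card (U \<inter> B)"
      by (subst eq, subst card_Un_disjoint) (use disj fin in auto)
    moreover have "nonattacking (U \<inter> A)" "nonattacking (U \<inter> B)"
      using U(3) by (auto simp: nonattacking_def intro: pairwise_subset)
    ultimately have "(U \<inter> A, U \<inter> B) \<in> ?P"
      using U(2) by (auto simp: placements_def intro!: bexI[of _ "card (U \<inter> A)"])
    then show "U \<in> ?g ` ?P"
      using eq by (metis (no_types, lifting) case_prod_conv image_eqI)
  next
    fix U assume "U \<in> ?g ` ?P"
    then obtain S T i where *: "i \<le> q" "S \<in> placements A i" "T \<in> placements B (q - i)" "U = S \<union> T"
      by auto
    then have ST: "S \<subseteq> A" "T \<subseteq> B" "card S = i" "card T = q - i" "nonattacking S" "nonattacking T"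
      by (auto simp: placements_def)
    then have "card (S \<union> T) = q"
      using *(1) fin disj by (subst card_Un_disjoint) (auto dest: finite_subset)
    moreover have "nonattacking (S \<union> T)"
      using ST sep nonattacking_Un[of S T] by blast
    ultimately show "U \<in> placements (A \<union> B) q"
      using ST * by (auto simp: placements_def)
  qed
  then have "card (placements (A \<union> B) q) = card ?P"
    using inj by (simp add: card_image)
  also have "\<dots> = (\<Sum>i\<le>q. card (placements A i \<times> placements B (q - i)))"
    using fin finite_placements
    by (intro card_UN_disjoint) (auto simp: placements_def)
  finally show ?thesis by (simp add: card_cartesian_product)
qed

section \<open>The two colour classes\<close>

definition diagonal :: "nat \<Rightarrow> int \<Rightarrow> (int \<times> int) set" where
  "diagonal n d = {z \<in> board n. fst z - snd z = d}"

lemma finite_board: "finite (board n)"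
proof -
  have "board n \<subseteq> {1..int n} \<times> {1..int n}" by (auto simp: board_def)
  then show ?thesis by (rule finite_subset) simp
qed

lemma finite_diagonal: "finite (diagonal n d)"
  unfolding diagonal_def using finite_board by simp

lemma card_diagonal: "\<bar>d\<bar> \<le> int n \<Longrightarrow> int (card (diagonal n d)) = int n - \<bar>d\<bar>"
proof -
  assume d: "\<bar>d\<bar> \<le> int n"
  have "diagonal n d = (\<lambda>x. (x, x - d)) ` {max 1 (1 + d)..min (int n) (int n + d)}"
    by (auto simp: diagonal_def board_def image_iff)
  moreover have "inj_on (\<lambda>x. (x, x - d)) {max 1 (1 + d)..min (int n) (int n + d)}"
    by (auto intro: inj_onI)
  ultimately show ?thesis using d by (auto simp add: card_image min_def max_def abs_if)
qed

text \<open>The antidiagonal through a cell of an earlier diagonal meets diagonal \<open>d\<close>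
  in a lattice point because the indices have equal parity, and inside the board because diagonal
  \<open>d\<close> is at least as long.\<close>

lemma card_placements_add_diagonal:
  assumes Ds: "finite Ds" "\<And>e. e \<in> Ds \<Longrightarrow> \<bar>d\<bar> \<le> \<bar>e\<bar> \<and> e \<noteq> d \<and> even (e - d)"
  shows "card (placements (\<Union>(diagonal n ` insert d Ds)) (Suc k))
       + k * card (placements (\<Union>(diagonal n ` Ds)) k)
     = card (placements (\<Union>(diagonal n ` Ds)) (Suc k))
       + card (diagonal n d) * card (placements (\<Union>(diagonal n ` Ds)) k)"
proof -
  let ?B = "\<Union>(diagonal n ` Ds)" and ?D = "diagonal n d"
  have "card (placements (?B \<union> ?D) (Suc k)) + k * card (placements ?B k) =
         card (placements ?B (Suc k)) + card ?D * card (placements ?B k)"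
  proof (rule card_placements_Un)
    show "finite ?B" "finite ?D" using Ds finite_diagonal by auto
    show "?B \<inter> ?D = {}" using Ds by (auto simp: diagonal_def)
    show "bishop_attacks z w" if "z \<in> ?D" "w \<in> ?D" for z w
      using that by (auto simp: diagonal_def bishop_attacks_iff)
    show "\<exists>!w. w \<in> ?D \<and> bishop_attacks z w" if "z \<in> ?B" for z
    proof -
      obtain x y where z: "z = (x, y)" by force
      have xy: "x - y \<in> Ds" "1 \<le> x" "x \<le> int n" "1 \<le> y" "y \<le> int n"
        using that by (auto simp: z diagonal_def board_def)
      then have e: "\<bar>d\<bar> \<le> \<bar>x - y\<bar>" "x - y \<noteq> d" "even (x - y - d)" using Ds by blast+
      \<comment> \<open>Moving half the difference of the indices along the antidiagonal lands on
        diagonal \<open>d\<close>.\<close>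
      then obtain m where m: "x - y - d = 2 * m" by (elim evenE)
      have "(x - m, y + m) \<in> ?D \<and> bishop_attacks z (x - m, y + m)"
        using xy e m by (auto simp: z diagonal_def board_def bishop_attacks_iff)
      moreover have "w = (x - m, y + m)" if "w \<in> ?D \<and> bishop_attacks z w" for w
        using that e(2) m by (cases w) (auto simp: z diagonal_def bishop_attacks_iff)
      ultimately show ?thesis by blast
    qed
    show "bishop_attacks z z'"
      if "z \<in> ?B" "z' \<in> ?B" "w \<in> ?D" "bishop_attacks z w" "bishop_attacks z' w" for z z' w
      using that Ds(2) by (auto simp: diagonal_def bishop_attacks_iff)
  qed
  then show ?thesis by (simp add: Un_commute)
qed

text \<open>Enumerates, by weakly increasing length, the diagonals of the colour
  \<open>x - y \<equiv> n + c + 1 (mod 2)\<close>; the length of the \<open>j\<close>-th one is \<open>j + 1\<close> or \<open>j\<close>.\<close>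
definition offset :: "nat \<Rightarrow> nat \<Rightarrow> nat \<Rightarrow> int" where
  "offset n c j = (if even (j + c) then int j + 1 - int n else int n - int j)"

definition partial_board :: "nat \<Rightarrow> nat \<Rightarrow> nat \<Rightarrow> (int \<times> int) set" where
  "partial_board n c i = \<Union>(diagonal n ` offset n c ` {..<i})"

lemma finite_partial_board: "finite (partial_board n c i)"
  unfolding partial_board_def using finite_diagonal by auto

lemma card_placements_partial_board_Suc:
  assumes "i < n"
  shows "card (placements (partial_board n c (Suc i)) (Suc k))
       + k * card (placements (partial_board n c i) k)
     = card (placements (partial_board n c i) (Suc k))
       + (if even (i + c) then i + 1 else i) * card (placements (partial_board n c i) k)"
proof -
  \<comment> \<open>The offsets weakly decrease in absolute value, do not repeat, and stay in one
    parity class.\<close>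
  have e: "\<bar>offset n c i\<bar> \<le> \<bar>e\<bar> \<and> e \<noteq> offset n c i \<and> even (e - offset n c i)"
    if e: "e \<in> offset n c ` {..<i}" for e
  proof -
    from e obtain j where "j < i" "e = offset n c j" by auto
    then show ?thesis
      using assms even_of_nat[of "j + c", where ?'a = int] even_of_nat[of "i + c", where ?'a = int]
      by (cases "even (j + c)"; cases "even (i + c)") (auto simp: offset_def)
  qed
  have "card (diagonal n (offset n c i)) = (if even (i + c) then i + 1 else i)"
    using card_diagonal[of "offset n c i" n] assms by (auto simp: offset_def)
  moreover have "partial_board n c (Suc i) = \<Union>(diagonal n ` insert (offset n c i) (offset n c ` {..<i}))"
    by (simp add: partial_board_def lessThan_Suc)
  ultimately show ?thesis
    using card_placements_add_diagonal[where Ds = "offset n c ` {..<i}", OF _ e, of n k]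
    unfolding partial_board_def by simp
qed

lemma partial_board_full:
  "partial_board n c n = {z \<in> board n. even (fst z - snd z + int n + int c + 1)}"
proof (intro equalityI subsetI)
  fix z assume "z \<in> partial_board n c n"
  then obtain j where j: "j < n" "z \<in> board n" "fst z - snd z = offset n c j"
    by (auto simp: partial_board_def diagonal_def)
  have "even (fst z - snd z + int n + int c + 1)"
    unfolding j(3) offset_def by auto
  with j(2) show "z \<in> {z \<in> board n. even (fst z - snd z + int n + int c + 1)}"
    by (intro CollectI conjI)
next
  fix z assume z: "z \<in> {z \<in> board n. even (fst z - snd z + int n + int c + 1)}"
  \<comment> \<open>The inverse of \<open>offset n c\<close>: for \<open>j < n\<close> its first
    branch gives the offsets that are at most 0, its second branch the positive ones.\<close>
  define j where "j = nat (if fst z - snd z \<le> 0 then fst z - snd z + int n - 1 else int n - (fst z - snd z))"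
  have j: "int j = (if fst z - snd z \<le> 0 then fst z - snd z + int n - 1 else int n - (fst z - snd z))"
    using z by (auto simp: j_def board_def)
  have par: "even (j + c) \<longleftrightarrow> even (int j + int c)"
    by (metis even_of_nat of_nat_add)
  have "j < n" using z j by (auto simp: board_def split: if_splits)
  moreover have "offset n c j = fst z - snd z"
    using z j unfolding offset_def par by (auto split: if_splits)
  ultimately show "z \<in> partial_board n c n"
    using z by (auto simp: partial_board_def diagonal_def intro!: bexI[of _ j])
qed

lemma bishop_count_colours:
  "bishop_count q n = (\<Sum>i\<le>q. card (placements (partial_board n 0 n) i)
                             * card (placements (partial_board n 1 n) (q - i)))"
proof -
  have "board n = partial_board n 0 n \<union> partial_board n 1 n"
    by (auto simp: partial_board_full)
  moreover have "bishop_count q n = card (placements (board n) q)"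
    by (simp add: bishop_count_def placements_def)
  moreover have sep: "\<not> bishop_attacks z w"
    if "z \<in> partial_board n 0 n" "w \<in> partial_board n 1 n" for z w
  proof
    assume "bishop_attacks z w"
    \<comment> \<open>\<open>x - y\<close> and \<open>x + y\<close> have the same parity, so both
      kinds of attack preserve the colour.\<close>
    then have "even ((fst z - snd z) - (fst w - snd w))"
      unfolding bishop_attacks_iff by presburger
    then show False using that by (auto simp: partial_board_full)
  qed
  moreover have "partial_board n 0 n \<inter> partial_board n 1 n = {}"
    by (auto simp: partial_board_full)
  ultimately show ?thesis
    by (simp add: card_placements_Un_separate[OF finite_partial_board finite_partial_board _ sep])
qed

section \<open>Interpolating polynomials\<close>

text \<open>Induction on the degree \<open>d\<close>: a multiple of
  \<open>y^(d+1) - (y-1)^(d+1)\<close>, itself the difference of a known polynomial, cancels the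
  leading term of \<open>p\<close>.\<close>

lemma ex_antidifference:
  fixes p :: "'a::field_char_0 poly"
  shows "\<exists>q. poly q 0 = 0 \<and> (\<forall>y. poly q y = poly q (y - 1) + poly p y)"
proof (induction "degree p" arbitrary: p rule: less_induct)
  case less
  show ?case
  proof (cases "p = 0")
    case True
    then show ?thesis by (intro exI[of _ 0]) simp
  next
    case False
    let ?d = "degree p"
    \<comment> \<open>\<open>y^(d+1) - (y-1)^(d+1)\<close> has leading coefficient
      \<open>d + 1\<close>.\<close>
    define a where "a = lead_coeff p / of_nat (Suc ?d)"
    define s where "s = smult a ([:0, 1:] ^ Suc ?d)"
    define t where "t = smult a ([:-1, 1:] ^ Suc ?d)"
    define r where "r = p - (s - t)"
    have st: "poly s y - poly t y = a * (y ^ Suc ?d - (y - 1) ^ Suc ?d)" for y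
      by (simp add: s_def t_def algebra_simps)
    have cs: "coeff s i = (if i = Suc ?d then a else 0)" for i
      unfolding s_def monom_altdef[symmetric] coeff_monom by auto
    have ct: "coeff t i = a * of_nat (Suc ?d choose i) * (-1) ^ (Suc ?d - i)" if "i \<le> Suc ?d" for i
      using that by (simp add: t_def coeff_linear_poly_power del: power_Suc)
    have dt: "degree t \<le> Suc ?d" "degree s \<le> Suc ?d"
      unfolding s_def t_def
      by (rule order_trans[OF degree_smult_le], simp add: degree_linear_power del: power_Suc)+
    have r0: "coeff r i = 0" if "i \<ge> ?d" for i
    proof -
      consider "i = ?d" | "i = Suc ?d" | "i > Suc ?d" using \<open>i \<ge> ?d\<close> by linarith
      then show ?thesis
      proof cases
        case 1
        then show ?thesis
          by (simp add: r_def cs ct a_def del: of_nat_Suc)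
      next
        case 2
        then show ?thesis by (simp add: r_def cs ct coeff_eq_0)
      next
        case 3
        then show ?thesis using dt by (simp add: r_def coeff_eq_0)
      qed
    qed
    have "\<exists>q. poly q 0 = 0 \<and> (\<forall>y. poly q y = poly q (y - 1) + poly r y)"
    \<comment> \<open>The zero polynomial has degree 0, which is not below \<open>degree p\<close>
      for constant \<open>p\<close>, so it is treated apart from the induction hypothesis.\<close>
    proof (cases "r = 0")
      case True
      then show ?thesis by (intro exI[of _ 0]) simp
    next
      case False
      then have "degree r < ?d" using r0 by (metis leading_coeff_0_iff not_le_imp_less)
      then show ?thesis using less by blast
    qed
    then obtain q where q: "poly q 0 = 0" "\<And>y. poly q y = poly q (y - 1) + poly r y" by blast
    show ?thesis
    proof (intro exI[of _ "q + s"] conjI allI)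
      show "poly (q + s) 0 = 0" using q(1) by (simp add: s_def)
      fix y
      have "poly p y = poly r y + a * (y ^ Suc ?d - (y - 1) ^ Suc ?d)"
        by (simp add: r_def st del: power_Suc)
      moreover have "poly s y = a * y ^ Suc ?d" "poly s (y - 1) = a * (y - 1) ^ Suc ?d"
        by (simp_all add: s_def)
      ultimately show "poly (q + s) y = poly (q + s) (y - 1) + poly p y"
        using q(2)[of y] by (simp add: right_diff_distrib del: power_Suc)
    qed
  qed
qed

text \<open>At naturals \<open>y\<close>, the value of \<open>second_stirling_poly l\<close> is the Stirling number of the second kind
  \<open>S(y + 1, y + 1 - l)\<close>.\<close>
primrec second_stirling_poly :: "nat \<Rightarrow> rat poly" where
  "second_stirling_poly 0 = 1"
| "second_stirling_poly (Suc l) = (SOME q. poly q 0 = 0 \<and>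
    (\<forall>y. poly q y = poly q (y - 1) + poly ([:- of_nat l, 1:] * pcompose (second_stirling_poly l) [:-1, 1:]) y))"

declare second_stirling_poly.simps(2) [simp del]

text \<open>The recurrence \<open>S(y + 1, y - l) = S(y, y - l - 1) + (y - l) S(y, y - l)\<close>,
  extended to all rational \<open>y\<close> by the antidifference.\<close>

lemma second_stirling_poly_Suc:
  shows poly_second_stirling_poly_Suc_0: "poly (second_stirling_poly (Suc l)) 0 = 0"
    and poly_second_stirling_poly_Suc: "poly (second_stirling_poly (Suc l)) y =
      poly (second_stirling_poly (Suc l)) (y - 1) + (y - of_nat l) * poly (second_stirling_poly l) (y - 1)"
proof -
  have *: "poly (second_stirling_poly (Suc l)) 0 = 0 \<and> (\<forall>y. poly (second_stirling_poly (Suc l)) y =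
      poly (second_stirling_poly (Suc l)) (y - 1)
      + poly ([:- of_nat l, 1:] * pcompose (second_stirling_poly l) [:-1, 1:]) y)"
    unfolding second_stirling_poly.simps(2) by (rule someI_ex[OF ex_antidifference])
  then show "poly (second_stirling_poly (Suc l)) 0 = 0" by blast
  show "poly (second_stirling_poly (Suc l)) y =
      poly (second_stirling_poly (Suc l)) (y - 1) + (y - of_nat l) * poly (second_stirling_poly l) (y - 1)"
    using * by (simp add: poly_pcompose algebra_simps)
qed

text \<open>The coefficient of the falling factorial of degree \<open>y - k\<close> in
  \<open>x\<^sup>b (x + 1)\<^sup>y\<^sup>-\<^sup>b = (x + 1)\<^sup>y (1 - 1 / (x + 1))\<^sup>b\<close>, extended to rational \<open>b\<close> and \<open>y\<close>.\<close>
definition rook_coeff :: "rat \<Rightarrow> nat \<Rightarrow> rat \<Rightarrow> rat" where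
  "rook_coeff b k y =
    (\<Sum>j\<le>k. (-1) ^ j * (b gchoose j) * poly (second_stirling_poly (k - j)) (y - of_nat j))"

lemma rook_coeff_0 [simp]: "rook_coeff b 0 y = 1"
  by (simp add: rook_coeff_def)

text \<open>Multiplication by \<open>x + 1\<close> sends the falling factorial of degree
  \<open>m\<close> to that of degree \<open>m + 1\<close> plus \<open>m + 1\<close> times itself.
  The summands obey this one by one, by the Stirling recurrence; the last one,
  \<open>j = Suc k\<close>, does not depend on \<open>y\<close>.\<close>

lemma rook_coeff_add1_right:
  "rook_coeff b (Suc k) (y + 1) = rook_coeff b (Suc k) y + (y + 1 - of_nat k) * rook_coeff b k y"
proof -
  have "(-1) ^ j * (b gchoose j) * poly (second_stirling_poly (Suc k - j)) (y + 1 - of_nat j)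
      = (-1) ^ j * (b gchoose j) * poly (second_stirling_poly (Suc k - j)) (y - of_nat j)
        + (y + 1 - of_nat k) * ((-1) ^ j * (b gchoose j) * poly (second_stirling_poly (k - j)) (y - of_nat j))"
    if "j \<le> k" for j
  proof -
    have eq: "poly (second_stirling_poly (Suc k - j)) (y + 1 - of_nat j)
        = poly (second_stirling_poly (Suc k - j)) (y - of_nat j)
          + (y + 1 - of_nat k) * poly (second_stirling_poly (k - j)) (y - of_nat j)"
      using that poly_second_stirling_poly_Suc[of "k - j" "y + 1 - of_nat j"]
      by (simp add: Suc_diff_le of_nat_diff algebra_simps)
    show ?thesis
      unfolding eq by (simp add: distrib_left mult.left_commute)
  qed
  then show ?thesis
    by (simp add: rook_coeff_def sum.distrib sum_distrib_left)
qed

text \<open>Pascal's rule for \<open>b gchoose j\<close>, reflecting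
  \<open>x = (x + 1) - 1\<close>.\<close>

lemma rook_coeff_add1_left:
  "rook_coeff (b + 1) (Suc k) y = rook_coeff b (Suc k) y - rook_coeff b k (y - 1)"
proof -
  have "rook_coeff (b + 1) (Suc k) y = poly (second_stirling_poly (Suc k)) y
      + (\<Sum>j\<le>k. (-1) ^ Suc j * (b gchoose Suc j) * poly (second_stirling_poly (k - j)) (y - of_nat (Suc j))
          + (-1) ^ Suc j * (b gchoose j) * poly (second_stirling_poly (k - j)) (y - of_nat (Suc j)))"
    unfolding rook_coeff_def sum.atMost_Suc_shift gbinomial_Suc_Suc
    by (simp add: left_diff_distrib distrib_left distrib_right add.commute)
  also have "\<dots> = rook_coeff b (Suc k) y - rook_coeff b k (y - 1)"
    unfolding rook_coeff_def sum.atMost_Suc_shift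
    by (simp add: sum_subtractf sum_negf diff_diff_eq)
  finally show ?thesis .
qed

text \<open>The analogue for multiplication by \<open>x\<close>, which sends the falling factorial
  of degree \<open>m\<close> to that of degree \<open>m + 1\<close> plus \<open>m\<close> times
  itself.\<close>

lemma rook_coeff_add1:
  "rook_coeff (b + 1) (Suc k) (y + 1) = rook_coeff b (Suc k) y + (y - of_nat k) * rook_coeff b k y"
  using rook_coeff_add1_left[of b k "y + 1"] rook_coeff_add1_right[of b k y]
  by (simp add: algebra_simps)

lemma rook_coeff_0_0: "rook_coeff 0 k 0 = (if k = 0 then 1 else 0)"
proof (cases k)
  case (Suc l)
  show ?thesis
    unfolding rook_coeff_def Suc sum.atMost_Suc_shift
    by (simp add: poly_second_stirling_poly_Suc_0)
qed simp

section \<open>The values at \<open>-1\<close>\<close>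

text \<open>Stirling duality: run towards negative arguments, the recurrence of the second kind
  becomes that of the unsigned numbers of the first kind, which are \<open>stirling\<close>.\<close>

lemma poly_second_stirling_poly_neg:
  "poly (second_stirling_poly l) (- 1 - of_nat j) = of_nat (stirling (l + j) j)"
proof (induction l arbitrary: j)
  case (Suc l)
  show ?case
  proof (induction j)
    case 0
    show ?case
      \<comment> \<open>At \<open>y = 0\<close> the recurrence gives \<open>l * stirling l 0\<close>
        as the value at -1, and this is 0 for every \<open>l\<close>.\<close>
      using poly_second_stirling_poly_Suc[of l 0] Suc.IH[of 0] poly_second_stirling_poly_Suc_0[of l]
      by (cases l) auto
  next
    case (Suc j)
    show ?case
      using poly_second_stirling_poly_Suc[of l "- 1 - of_nat j"] Suc.IH \<open>\<And>j. poly (second_stirling_poly l) (- 1 - of_nat j) = _\<close>[of "Suc j"]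
      by (simp add: algebra_simps)
  qed
qed simp

lemma rook_coeff_neg1:
  "rook_coeff b k (-1) = (\<Sum>j\<le>k. pochhammer (- b) j / fact j * of_nat (stirling k j))"
proof -
  have "(-1) ^ j * (b gchoose j) = pochhammer (- b) j / fact j" for j
    by (simp add: gbinomial_pochhammer flip: power_add mult.assoc)
  moreover have "poly (second_stirling_poly (k - j)) (- 1 - of_nat j) = of_nat (stirling k j)" if "j \<le> k" for j
    using that poly_second_stirling_poly_neg[of "k - j" j] by simp
  ultimately show ?thesis
    unfolding rook_coeff_def by (intro sum.cong) auto
qed

text \<open>Since \<open>pochhammer 1 j = fact j\<close>, all weights are 1, and a row of Stirling
  numbers of the first kind sums to \<open>fact k\<close>.\<close>

lemma rook_coeff_neg1_neg1: "rook_coeff (-1) k (-1) = fact k"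
proof -
  have "rook_coeff (-1) k (-1) = of_nat (\<Sum>j\<le>k. stirling k j)"
    by (simp add: rook_coeff_neg1 pochhammer_fact flip: pochhammer_fact)
  then show ?thesis by (simp add: sum_stirling)
qed

lemma rook_coeff_0_neg1: "rook_coeff 0 k (-1) = (if k = 0 then 1 else 0)"
  by (cases k) (simp_all add: rook_coeff_neg1 sum.atMost_Suc_shift pochhammer_0_left del: sum.atMost_Suc)

section \<open>Bounds at \<open>b = -1/2\<close>, the value of \<open>n/2\<close> at
  \<open>n = -1\<close>, against factorials\<close>

definition half_coeff :: "nat \<Rightarrow> rat" where
  "half_coeff k = rook_coeff (-1/2) k (-1)"

lemma half_coeff_eq:
  "half_coeff k = (\<Sum>j\<le>k. pochhammer (1/2) j / fact j * of_nat (stirling k j))"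
  by (simp add: half_coeff_def rook_coeff_neg1)

lemma half_coeff_nonneg: "half_coeff k \<ge> 0"
  unfolding half_coeff_eq by (intro sum_nonneg mult_nonneg_nonneg divide_nonneg_nonneg pochhammer_nonneg) auto

lemma half_coeff_values:
  "half_coeff 0 = 1" "half_coeff 1 = 1/2" "half_coeff 2 = 7/8" "half_coeff 3 = 39/16"
  "half_coeff 4 = 1187/128"
  by (simp_all add: half_coeff_eq eval_nat_numeral pochhammer_Suc)

text \<open>The weights \<open>m j\<close> decrease weakly, so in the Stirling recurrence the part
  with shifted index contributes at most \<open>half_coeff k\<close>, and the other part exactly
  \<open>k * half_coeff k\<close>.\<close>

lemma half_coeff_Suc_le: "half_coeff (Suc k) \<le> of_nat (Suc k) * half_coeff k"
proof -
  define m where "m j = (pochhammer (1/2) j / fact j :: rat)" for j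
  have h: "half_coeff i = (\<Sum>j\<le>i. m j * of_nat (stirling i j))" for i
    by (simp add: half_coeff_eq m_def)
  have m: "m (Suc j) \<le> m j" for j
  proof -
    have "m (Suc j) = m j * ((1/2 + of_nat j) / of_nat (Suc j))"
      by (simp add: m_def pochhammer_Suc field_simps)
    also have "\<dots> \<le> m j * 1"
      unfolding m_def by (intro mult_left_mono divide_nonneg_nonneg pochhammer_nonneg) auto
    finally show ?thesis by simp
  qed
  have "half_coeff (Suc k) = (\<Sum>j\<le>k. m (Suc j) * of_nat (stirling (Suc k) (Suc j)))"
    unfolding h sum.atMost_Suc_shift by simp
  also have "\<dots> = (\<Sum>j\<le>k. of_nat k * (m (Suc j) * of_nat (stirling k (Suc j))))
      + (\<Sum>j\<le>k. m (Suc j) * of_nat (stirling k j))"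
    by (simp add: algebra_simps sum.distrib)
  \<comment> \<open>For positive \<open>k\<close> both \<open>stirling k 0\<close> and
    \<open>stirling k (Suc k)\<close> vanish, so the index shift loses nothing; for
    \<open>k = 0\<close> the factor \<open>k\<close> kills the sum.\<close>
  also have "(\<Sum>j\<le>k. of_nat k * (m (Suc j) * of_nat (stirling k (Suc j)))) = of_nat k * half_coeff k"
  proof (cases k)
    case (Suc l)
    have "half_coeff k = (\<Sum>j\<le>l. m (Suc j) * of_nat (stirling k (Suc j)))"
      unfolding h Suc sum.atMost_Suc_shift by simp
    then show ?thesis by (simp add: Suc sum_distrib_left del: stirling.simps)
  qed simp
  also have "(\<Sum>j\<le>k. m (Suc j) * of_nat (stirling k j)) \<le> half_coeff k"
    unfolding h by (intro sum_mono mult_right_mono m) auto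
  finally show ?thesis by (simp add: algebra_simps)
qed

text \<open>\<open>half_coeff k / fact k\<close> never increases, so one computed value bounds all
  later ones.\<close>

lemma half_coeff_le:
  assumes "half_coeff m \<le> c * fact m" "m \<le> k"
  shows "half_coeff k \<le> c * fact k"
  using assms(2)
proof (induction k rule: dec_induct)
  case (step k)
  have "half_coeff (Suc k) \<le> of_nat (Suc k) * half_coeff k" by (rule half_coeff_Suc_le)
  also have "\<dots> \<le> of_nat (Suc k) * (c * fact k)" using step by (intro mult_left_mono) auto
  finally show ?case by (simp add: algebra_simps)
qed (use assms in simp)

text \<open>The bound is \<open>fact (i + j + 2)\<close> without its last factor; the saved factor
  absorbs the number of middle terms in the convolution.\<close>

lemma fact_mult_fact_le: "fact (Suc i) * fact (Suc j) \<le> (fact (Suc (i + j)) :: rat)"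
proof (induction i)
  case (Suc i)
  have "fact (Suc (Suc i)) * fact (Suc j) = of_nat (Suc (Suc i)) * (fact (Suc i) * fact (Suc j) :: rat)"
    by (simp add: algebra_simps)
  also have "\<dots> \<le> of_nat (Suc (Suc (i + j))) * fact (Suc (i + j))"
    using Suc by (intro mult_mono) auto
  finally show ?case by simp
qed simp

text \<open>For \<open>i = 1\<close> the constant is \<open>1/2\<close> times
  \<open>half_coeff 3 / fact 3 = 13/32\<close>. Otherwise both ratios are at most
  \<open>half_coeff 2 / fact 2 = 7/16\<close>, and \<open>49/256 < 13/64\<close>.\<close>

lemma half_coeff_mult_le:
  assumes "4 \<le> i + j" "0 < i" "i \<le> j"
  shows "half_coeff i * half_coeff j \<le> 13/64 * (fact i * fact j)"
proof (cases "i = 1")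
  case True
  then have "half_coeff j \<le> 13/32 * fact j"
    using assms by - (rule half_coeff_le[where m = 3], simp_all add: half_coeff_values fact_numeral)
  then have "1/2 * half_coeff j \<le> 13/64 * (1 * fact j)" by simp
  then show ?thesis by (simp only: True half_coeff_values fact_1)
next
  case False
  have "half_coeff k \<le> 7/16 * fact k" if "2 \<le> k" for k
    using that by (rule half_coeff_le[where m = 2, rotated]) (simp add: half_coeff_values fact_numeral)
  moreover have "2 \<le> i" "2 \<le> j" using assms False by simp_all
  ultimately have "half_coeff i \<le> 7/16 * fact i" "half_coeff j \<le> 7/16 * fact j" by blast+
  then have "half_coeff i * half_coeff j \<le> (7/16 * fact i) * (7/16 * fact j)"
    by (intro mult_mono half_coeff_nonneg) auto
  also have "\<dots> = 49/256 * (fact i * fact j)" by simp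
  also have "\<dots> \<le> 13/64 * (fact i * fact j)" by (intro mult_right_mono) auto
  finally show ?thesis .
qed

text \<open>For \<open>q\<close> at least 4 the two end terms give at most \<open>1187/1536\<close>
  of \<open>fact q\<close> and the middle terms at most \<open>13/64\<close>, together
  \<open>1499/1536\<close>. The case \<open>q = 3\<close> is computed, as its middle products have
  ratio \<open>7/32 > 13/64\<close>.\<close>

lemma sum_half_coeff_less:
  assumes "q \<ge> 3"
  shows "(\<Sum>i\<le>q. half_coeff i * half_coeff (q - i)) < fact q"
proof (cases "q = 3")
  case True
  have "(\<Sum>i\<le>q. half_coeff i * half_coeff (q - i)) = 2 * half_coeff 3 + 2 * (half_coeff 1 * half_coeff 2)"
    by (simp add: True half_coeff_values(1) eval_nat_numeral)
  also have "\<dots> < fact q"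
    unfolding half_coeff_values True by (simp add: fact_numeral)
  finally show ?thesis .
next
  case False
  define r where "r = q - 2"
  have q: "q = Suc (Suc r)" "r \<ge> 2"
    using assms False by (auto simp: r_def)
  have mid: "half_coeff (Suc i) * half_coeff (q - Suc i) \<le> 13/64 * fact (Suc r)" if "i \<le> r" for i
  proof -
    define j where "j = r - i"
    have ij: "q - Suc i = Suc j" "r = i + j" using that q by (auto simp: j_def)
    have "half_coeff (Suc i) * half_coeff (Suc j) \<le> 13/64 * (fact (Suc i) * fact (Suc j))"
      using half_coeff_mult_le[of "Suc i" "Suc j"] half_coeff_mult_le[of "Suc j" "Suc i"] q ij
      by (cases "i \<le> j") (auto simp: mult.commute)
    also have "\<dots> \<le> 13/64 * fact (Suc r)"
      using fact_mult_fact_le[of i j] unfolding ij(2) by (intro mult_left_mono) auto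
    finally show ?thesis using ij by simp
  qed
  have "(\<Sum>i\<le>q. half_coeff i * half_coeff (q - i))
      = 2 * half_coeff q + (\<Sum>i\<le>r. half_coeff (Suc i) * half_coeff (q - Suc i))"
    unfolding q(1) sum.atMost_Suc[of _ "Suc r"] sum.atMost_Suc_shift[of _ r]
    by (simp add: half_coeff_values)
  also have "\<dots> \<le> 2 * (1187/3072 * fact q) + (\<Sum>i\<le>r. 13/64 * fact (Suc r))"
  proof (intro add_mono mult_left_mono sum_mono)
    \<comment> \<open>The constant is \<open>half_coeff 4 / fact 4\<close>.\<close>
    show "half_coeff q \<le> 1187/3072 * fact q"
      by (rule half_coeff_le[where m = 4]) (use q in \<open>simp_all add: half_coeff_values fact_numeral\<close>)
  qed (use mid in auto)
  also have "(\<Sum>i\<le>r. 13/64 * fact (Suc r)) = 13/64 * (of_nat (Suc r) * fact (Suc r) :: rat)"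
    by simp
  also have "of_nat (Suc r) * fact (Suc r) \<le> (fact q :: rat)"
    unfolding q(1) fact_Suc[of "Suc r"] by (intro mult_right_mono) auto
  also have "2 * (1187/3072 * fact q) + 13/64 * fact q < (fact q :: rat)" by simp
  finally show ?thesis by simp
qed

section \<open>The counting quasipolynomial\<close>

definition rook_poly :: "rat \<Rightarrow> nat \<Rightarrow> rat poly" where
  "rook_poly d k = (\<Sum>j\<le>k. smult ((-1) ^ j / fact j) ((\<Prod>i<j. [:d - of_nat i, 1/2:]) *
    pcompose (second_stirling_poly (k - j)) [:- of_nat j, 1:]))"

lemma poly_rook_poly: "poly (rook_poly d k) y = rook_coeff (y / 2 + d) k y"
proof -
  have "(y / 2 + d) gchoose j = (\<Prod>i<j. d - of_nat i + y / 2) / fact j" for j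
    by (simp add: gbinomial_prod_rev atLeast0LessThan algebra_simps)
  then show ?thesis
    by (simp add: rook_poly_def rook_coeff_def poly_sum poly_prod poly_pcompose algebra_simps)
qed

text \<open>\<open>d\<close> is half the difference between the values of \<open>b\<close> for the
  two colours: 0 for even \<open>n\<close>, \<open>1/2\<close> for odd \<open>n\<close>.\<close>

definition bishop_poly :: "rat \<Rightarrow> nat \<Rightarrow> rat poly" where
  "bishop_poly d q = (\<Sum>i\<le>q. rook_poly (- d) i * rook_poly d (q - i))"

lemma poly_bishop_poly:
  "poly (bishop_poly d q) y =
    (\<Sum>i\<le>q. rook_coeff (y / 2 - d) i y * rook_coeff (y / 2 + d) (q - i) y)"
  by (simp add: bishop_poly_def poly_sum poly_rook_poly)

text \<open>\<open>(i + c) div 2\<close> counts the steps whose diagonal has length \<open>j\<close>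
  at index \<open>j\<close>; they multiply by \<open>x\<close>, the steps with length
  \<open>j + 1\<close> by \<open>x + 1\<close>. As \<open>c < 2\<close>, the count starts at
  0.\<close>

lemma card_placements_partial_board:
  assumes "c < 2" "i \<le> n"
  shows "of_nat (card (placements (partial_board n c i) k)) = rook_coeff (of_nat ((i + c) div 2)) k (of_nat i)"
  using assms(2)
proof (induction i arbitrary: k)
  case 0
  have "partial_board n c 0 = {}" by (simp add: partial_board_def)
  then show ?case
    using assms(1) by (cases k) (simp_all add: placements_0 placements_empty_Suc rook_coeff_0_0)
next
  case (Suc i)
  show ?case
  proof (cases k)
    case 0
    then show ?thesis by (simp add: placements_0 finite_partial_board)
  next
    case (Suc l)
    let ?N = "\<lambda>i k. of_nat (card (placements (partial_board n c i) k)) :: rat"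
    have IH: "?N i k = rook_coeff (of_nat ((i + c) div 2)) k (of_nat i)" for k
      using Suc.IH Suc.prems by simp
    have "?N (Suc i) (Suc l) + of_nat l * ?N i l
        = ?N i (Suc l) + of_nat (if even (i + c) then i + 1 else i) * ?N i l"
      using card_placements_partial_board_Suc[of i n c l] Suc.prems
      by (metis Suc_le_lessD of_nat_add of_nat_mult)
    then have *: "?N (Suc i) (Suc l)
        = ?N i (Suc l) + (of_nat (if even (i + c) then i + 1 else i) - of_nat l) * ?N i l"
      by (simp add: algebra_simps)
    show ?thesis
    proof (cases "even (i + c)")
      case True
      then have "(Suc i + c) div 2 = (i + c) div 2" by simp
      then show ?thesis
        using * True rook_coeff_add1_right[of _ l "of_nat i"] by (simp add: Suc IH add.commute)
    next
      case False
      then have "(Suc i + c) div 2 = (i + c) div 2 + 1" by simp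
      then show ?thesis
        using * False rook_coeff_add1[of "of_nat ((i + c) div 2)" l "of_nat i"] by (simp add: Suc IH add.commute)
    qed
  qed
qed

lemma bishop_count_eq_poly:
  "of_nat (bishop_count q n) = poly (bishop_poly (if even n then 0 else 1/2) q) (of_nat n)"
proof -
  define d :: rat where "d = (if even n then 0 else 1/2)"
  have "of_nat (n div 2) = of_nat n / 2 - d" "of_nat ((n + 1) div 2) = of_nat n / 2 + d"
    by (auto simp: d_def add_divide_distrib elim!: evenE oddE)
  then have "of_nat (bishop_count q n) = poly (bishop_poly d q) (of_nat n)"
    using card_placements_partial_board[of 0 n n] card_placements_partial_board[of 1 n n]
    by (simp add: bishop_count_colours poly_bishop_poly)
  then show ?thesis by (simp add: d_def)
qed

lemma quasipolynomial_mod_2_bishops: "quasipolynomial_mod 2 (\<lambda>n. of_nat (fact q * bishop_count q n))"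
  unfolding quasipolynomial_mod_def
  by (intro conjI exI[of _ "\<lambda>r. smult (fact q) (bishop_poly (if even r then 0 else 1/2) q)"])
    (simp_all add: bishop_count_eq_poly)

section \<open>Period 1 as equality of the even and odd polynomials\<close>

lemma poly_eqI_infinite:
  fixes p r :: "'a::idom poly"
  assumes "inj f" "\<And>n::nat. poly p (f n) = poly r (f n)"
  shows "p = r"
proof (rule ccontr)
  assume "p \<noteq> r"
  then have "finite {x. poly (p - r) x = 0}" by (intro poly_roots_finite) simp
  moreover have "range f \<subseteq> {x. poly (p - r) x = 0}" using assms(2) by auto
  ultimately show False using assms(1) finite_imageD finite_subset infinite_UNIV_nat by blast
qed

text \<open>A single polynomial agrees with one constituent at all positive even \<open>n\<close>
  and with the other at all odd \<open>n\<close>; both sets are infinite.\<close>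

lemma quasipolynomial_mod_1_bishops_iff:
  "quasipolynomial_mod 1 (\<lambda>n. of_nat (fact q * bishop_count q n)) \<longleftrightarrow>
    bishop_poly 0 q = bishop_poly (1/2) q"
proof
  assume "quasipolynomial_mod 1 (\<lambda>n. of_nat (fact q * bishop_count q n))"
  then obtain F where "\<forall>n\<ge>1. of_nat (fact q * bishop_count q n) = poly (F (n mod 1)) (of_nat n :: rat)"
    unfolding quasipolynomial_mod_def by blast
  then obtain p :: "rat poly"
    where p: "fact q * of_nat (bishop_count q n) = poly p (of_nat n)" if "n \<ge> 1" for n
    using that[of "F 0"] by simp
  have "smult (fact q) (bishop_poly 0 q) = p"
  proof (rule poly_eqI_infinite)
    \<comment> \<open>The summand 2 avoids \<open>n = 0\<close>, where nothing is assumed.\<close>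
    show "inj (\<lambda>m. of_nat (2 * m + 2) :: rat)" by (auto intro: injI)
    show "poly (smult (fact q) (bishop_poly 0 q)) (of_nat (2 * m + 2)) = poly p (of_nat (2 * m + 2))" for m
      using p[of "2 * m + 2"] bishop_count_eq_poly[of q "2 * m + 2"] by simp
  qed
  moreover have "smult (fact q) (bishop_poly (1/2) q) = p"
  proof (rule poly_eqI_infinite)
    show "inj (\<lambda>m. of_nat (2 * m + 1) :: rat)" by (auto intro: injI)
    show "poly (smult (fact q) (bishop_poly (1/2) q)) (of_nat (2 * m + 1)) = poly p (of_nat (2 * m + 1))" for m
      using p[of "2 * m + 1"] bishop_count_eq_poly[of q "2 * m + 1"] by simp
  qed
  ultimately have "smult (fact q) (bishop_poly 0 q) = smult (fact q) (bishop_poly (1/2) q)" by simp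
  then show "bishop_poly 0 q = bishop_poly (1/2) q"
    by (metis fact_nonzero smult_cancel)
next
  assume "bishop_poly 0 q = bishop_poly (1/2) q"
  then show "quasipolynomial_mod 1 (\<lambda>n. of_nat (fact q * bishop_count q n))"
    unfolding quasipolynomial_mod_def
    by (intro conjI exI[of _ "\<lambda>_. smult (fact q) (bishop_poly 0 q)"]) (simp_all add: bishop_count_eq_poly)
qed

text \<open>At -1 the two values of \<open>b\<close> are \<open>-1/2\<close>, \<open>-1/2\<close>
  for \<open>d = 0\<close> and \<open>-1\<close>, \<open>0\<close> for \<open>d = 1/2\<close>. In
  the latter case \<open>b = 0\<close> leaves only the term \<open>i = q\<close> of the
  convolution.\<close>

lemma bishop_poly_neq:
  assumes "q \<ge> 3"
  shows "bishop_poly 0 q \<noteq> bishop_poly (1/2) q"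
proof -
  have "poly (bishop_poly 0 q) (-1) = (\<Sum>i\<le>q. half_coeff i * half_coeff (q - i))"
    by (simp add: poly_bishop_poly half_coeff_def)
  also have "\<dots> < fact q" using assms by (rule sum_half_coeff_less)
  also have "fact q = (\<Sum>i\<le>q. fact i * (if q - i = 0 then 1 else 0) :: rat)"
    by (subst sum.remove[of _ q]) auto
  also have "\<dots> = poly (bishop_poly (1/2) q) (-1)"
    by (simp add: poly_bishop_poly rook_coeff_neg1_neg1 rook_coeff_0_neg1)
  finally show ?thesis by auto
qed

text \<open>For \<open>q = 2\<close> the terms quadratic in the two parameters \<open>b\<close>,
  \<open>b'\<close> add up to \<open>(b + b')^2 / 2\<close>, the others involve only
  \<open>b + b'\<close>, and \<open>b + b' = y\<close> for either \<open>d\<close>.\<close>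

lemma bishop_poly_eq:
  assumes "q < 3"
  shows "bishop_poly 0 q = bishop_poly (1/2) q"
proof -
  let ?W = "\<lambda>l y. poly (second_stirling_poly l) y"
  have 1: "rook_coeff b (Suc 0) y = ?W 1 y - b" for b y
    by (simp add: rook_coeff_def)
  have 2: "rook_coeff b (Suc (Suc 0)) y = ?W 2 y - b * ?W 1 (y - 1) + b * (b - 1) / 2" for b y
    by (simp add: rook_coeff_def numeral_2_eq_2 gbinomial_Suc)
  consider "q = 0" | "q = 1" | "q = 2" using assms by linarith
  then have "poly (bishop_poly 0 q) y = poly (bishop_poly (1/2) q) y" for y
    by cases (simp_all add: poly_bishop_poly numeral_2_eq_2 1 2, simp_all add: field_simps)
  then show ?thesis by (metis poly_eq_poly_eq_iff ext)
qed

theorem theorem1p1: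
  shows "(\<forall>q::nat. q \<ge> 3 \<longrightarrow>
            quasipolynomial (\<lambda>n. of_nat (fact q * bishop_count q n)) \<and>
            period (\<lambda>n. of_nat (fact q * bishop_count q n)) = 2) \<and>
         (\<forall>q::nat. 1 \<le> q \<and> q < 3 \<longrightarrow>
            quasipolynomial (\<lambda>n. of_nat (fact q * bishop_count q n)) \<and>
            period (\<lambda>n. of_nat (fact q * bishop_count q n)) = 1)"
proof (intro conjI allI impI)
  fix q :: nat
  let ?f = "\<lambda>n. of_nat (fact q * bishop_count q n) :: rat"
  show quasi: "quasipolynomial ?f"
    using quasipolynomial_mod_2_bishops unfolding quasipolynomial_def by blast
  then show "quasipolynomial ?f" .
  have pos: "p \<ge> 1" if "quasipolynomial_mod p ?f" for p
    using that by (simp add: quasipolynomial_mod_def)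
  {
    assume "q \<ge> 3"
    then have "\<not> quasipolynomial_mod 1 ?f"
      unfolding quasipolynomial_mod_1_bishops_iff by (rule bishop_poly_neq)
    then have "p \<ge> 2" if "quasipolynomial_mod p ?f" for p
      using pos[OF that] that by (cases "p = 1") auto
    then show "period ?f = 2"
      unfolding period_def using quasipolynomial_mod_2_bishops by (intro Least_equality)
  next
    assume "1 \<le> q \<and> q < 3"
    then have "quasipolynomial_mod 1 ?f"
      unfolding quasipolynomial_mod_1_bishops_iff by (intro bishop_poly_eq) simp
    then show "period ?f = 1"
      unfolding period_def using pos by (intro Least_equality)
  }
qed

end
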